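(* Let $G$ be a locally compact Hausdorff abelian group, let $1<p<\infty$, and let $\omega: G\to(0,\infty)$ be a diagonally bounded weight. If $L^p_{\omega}(G)$ is closed under convolution, i.e. $L^p_{\omega}(G)\star L^p_{\omega}(G)\subset L^p_{\omega}(G)$, then $G$ is compact.
   Context: $G$ carries a left Haar measure $\mu$. A weight on $G$ is a measurable function $\omega:G\to(0,\infty)$ which is submultiplicative: $\omega(xy)\le\omega(x)\,\omega(y)$ for all $x,y\in G$. A weight $\omega$ is diagonally bounded if there is $M>0$ such that $\omega(x)\,\omega(x^{-1})<M$ for all $x\in G$. $L^p_{\omega}(G)$ is the Banach space of (a.e.-equivalence classes of) measurable functions $f:G\to\mathbb{C}$ with $\int_G |f\omega|^p\,d\mu<\infty$, with norm $\|f\|_{p,\omega}=\|f\omega\|_{L^p(\mu)}$. The convolution of measurable functions $f,g:G\to\mathbb{C}$ is $(f\star g)(x)=\int_G f(y)\,g(y^{-1}x)\,d\mu(y)$. "$L^p_\omega(G)$ is closed under convolution" means that for all $f,g\in L^p_\omega(G)$ the convolution $f\star g$ is defined almost everywhere and belongs to $L^p_\omega(G)$. *)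

theory Defs
  imports "HOL-Analysis.Analysis"
begin

text \<open>Groups are written additively: \<open>x * y\<close> becomes \<open>x + y\<close>, and the inverse of \<open>x\<close> becomes \<open>- x\<close>.\<close>

text \<open>
  Borel measures that are finite on compact sets, outer regular on Borel sets and inner regular on
  open sets.  Inner regularity is deliberately not demanded of all Borel sets: Haar measure on a
  group that is not \<open>\<sigma>\<close>-compact need not have it.
\<close>

definition radon_measure :: "'a::t2_space measure \<Rightarrow> bool" where
  "radon_measure \<mu> \<longleftrightarrow>
     sets \<mu> = sets borel \<and>
     (\<forall>K. compact K \<longrightarrow> emeasure \<mu> K < \<infinity>) \<and>
     (\<forall>A\<in>sets borel. emeasure \<mu> A = (INF U\<in>{U. open U \<and> A \<subseteq> U}. emeasure \<mu> U)) \<and>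
     (\<forall>U. open U \<longrightarrow> emeasure \<mu> U = (SUP K\<in>{K. compact K \<and> K \<subseteq> U}. emeasure \<mu> K))"

definition left_haar_measure :: "'a::{topological_group_add, t2_space} measure \<Rightarrow> bool" where
  "left_haar_measure \<mu> \<longleftrightarrow>
     radon_measure \<mu> \<and>
     emeasure \<mu> UNIV \<noteq> 0 \<and>
     (\<forall>x. \<forall>A\<in>sets borel. emeasure \<mu> ((\<lambda>y. x + y) ` A) = emeasure \<mu> A)"

definition weight :: "('a::topological_group_add \<Rightarrow> real) \<Rightarrow> bool" where
  "weight \<omega> \<longleftrightarrow>
     \<omega> \<in> borel_measurable borel \<and>
     (\<forall>x. 0 < \<omega> x) \<and>
     (\<forall>x y. \<omega> (x + y) \<le> \<omega> x * \<omega> y)"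

definition diagonally_bounded :: "('a::group_add \<Rightarrow> real) \<Rightarrow> bool" where
  "diagonally_bounded \<omega> \<longleftrightarrow> (\<exists>M>0. \<forall>x. \<omega> x * \<omega> (- x) < M)"

text \<open>
  The functions representing the elements of the weighted space; the identification of functions
  that agree almost everywhere is made explicit in \<open>closed_under_convolution\<close>.
\<close>

definition weighted_Lp :: "'a measure \<Rightarrow> real \<Rightarrow> ('a \<Rightarrow> real) \<Rightarrow> ('a \<Rightarrow> complex) set" where
  "weighted_Lp \<mu> p \<omega> =
     {f \<in> borel_measurable \<mu>. (\<integral>\<^sup>+ x. ennreal (cmod (f x * complex_of_real (\<omega> x)) powr p) \<partial>\<mu>) < \<infinity>}"

definition convolution ::
    "'a::group_add measure \<Rightarrow> ('a \<Rightarrow> complex) \<Rightarrow> ('a \<Rightarrow> complex) \<Rightarrow> 'a \<Rightarrow> complex" where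
  "convolution \<mu> f g x = (\<integral>y. f y * g (- y + x) \<partial>\<mu>)"

text \<open>
  The Bochner integral of a non-integrable function is 0 by convention, so that the convolution is
  defined almost everywhere has to be required separately.  It belongs to the space when it agrees
  almost everywhere with a representative.
\<close>

definition closed_under_convolution ::
    "'a::group_add measure \<Rightarrow> real \<Rightarrow> ('a \<Rightarrow> real) \<Rightarrow> bool" where
  "closed_under_convolution \<mu> p \<omega> \<longleftrightarrow>
     (\<forall>f\<in>weighted_Lp \<mu> p \<omega>. \<forall>g\<in>weighted_Lp \<mu> p \<omega>.
        (AE x in \<mu>. integrable \<mu> (\<lambda>y. f y * g (- y + x))) \<and>
        (\<exists>h\<in>weighted_Lp \<mu> p \<omega>. AE x in \<mu>. convolution \<mu> f g x = h x))"

end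

theory Submission
  imports Defs "HOL-Real_Asymp.Real_Asymp"
begin

text \<open>
  Since \<open>\<omega> x \<le> \<omega> (x + y) * \<omega> (- y)\<close>, a diagonally bounded weight satisfies
  \<open>\<omega> x * \<omega> y \<le> M * \<omega> (x + y)\<close>; so for nonnegative functions convolution on the weighted space
  dominates convolution on the unweighted one, up to the factor \<open>M\<close>.

  If the group is not compact, it has symmetric compact neighbourhoods \<open>K\<close> of 0 of arbitrarily
  large measure.  The \<open>n\<close>-fold sums of \<open>K\<close> grow polynomially in measure, hence one of them, \<open>A\<close>,
  satisfies \<open>|K + A| \<le> 2|A|\<close>.  On \<open>A\<close> the convolution of the indicators of \<open>K + A\<close> and \<open>K\<close> is
  constantly \<open>|K|\<close>, so relative to the product of the norms its norm is at least of the order of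
  \<open>|K|\<close> to the power \<open>1 - 1/p\<close>.  A gliding hump over a sequence of such sets gives two functions
  whose convolution is not in the space.
\<close>

section \<open>Compact sums and polynomial growth\<close>

lemma compact_set_plus:
  fixes A B :: "'a::topological_monoid_add set"
  assumes "compact A" "compact B"
  shows "compact (A + B)"
  unfolding set_plus_image case_prod_unfold
  by (intro compact_continuous_image compact_Times assms continuous_intros)

lemma compact_covered_by_translates:
  fixes C V :: "'a::topological_group_add set"
  assumes "compact C" and "0 \<in> interior V"
  obtains F where "finite F" and "C \<subseteq> F + V"
proof -
  define U where "U x = (\<lambda>y. - x + y) -` interior V" for x
  have "open (U x)" for x
    unfolding U_def by (intro open_vimage open_interior continuous_intros)
  moreover have "C \<subseteq> \<Union> (U ` C)"
    using assms(2) by (auto simp: U_def)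
  ultimately obtain F where F: "finite F" "C \<subseteq> \<Union> (U ` F)"
    using compactE_image[OF assms(1), of C U] by metis
  have "C \<subseteq> F + V"
  proof
    fix y assume "y \<in> C"
    then obtain x where "x \<in> F" "- x + y \<in> V"
      using F(2) interior_subset unfolding U_def by blast
    then show "y \<in> F + V"
      using set_plus_intro[of x F "- x + y" V] by (simp add: add.assoc[symmetric])
  qed
  with F(1) that show ?thesis by blast
qed

text \<open>Each further summand \<open>K\<close> is traded, through
  \<open>K + K \<subseteq> F + K\<close>, for a single element of \<open>F\<close>. By commutativity
  a sum of elements of \<open>F\<close> depends only on how often each one occurs, which gives a
  polynomial count in place of an exponential one. The iterate \<open>((+) K ^^ n) K\<close> has
  \<open>n + 1\<close> copies of \<open>K\<close>.\<close>

lemma iterated_sumset_covered: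
  fixes K F :: "'a::ab_group_add set"
  assumes "finite F" and "K + K \<subseteq> F + K"
  obtains T where "finite T" and "card T \<le> (n + 1) ^ card F" and "((+) K ^^ n) K \<subseteq> T + K"
proof -
  \<comment> \<open>\<open>m a\<close> is the multiplicity of \<open>a\<close>; the inner constant
    sum is the multiple of \<open>a\<close> by \<open>m a\<close>.\<close>
  define \<sigma> :: "('a \<Rightarrow> nat) \<Rightarrow> 'a" where "\<sigma> m = (\<Sum>a\<in>F. \<Sum>i<m a. a)" for m
  \<comment> \<open>Bounding each multiplicity by \<open>n\<close>, rather than fixing their total,
    makes the count exactly \<open>(n + 1) ^ card F\<close>.\<close>
  define P where "P n = F \<rightarrow>\<^sub>E {..n::nat}" for n
  have "((+) K ^^ n) K \<subseteq> \<sigma> ` P n + K" for n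
  proof (induction n)
    case 0
    have "(\<lambda>a\<in>F. 0) \<in> P 0" "\<sigma> (\<lambda>a\<in>F. 0) = 0"
      by (auto simp: P_def \<sigma>_def)
    then have "0 \<in> \<sigma> ` P 0"
      by (metis image_eqI)
    then show ?case
      using set_zero_plus2[of "\<sigma> ` P 0" K] by simp
  next
    case (Suc n)
    show ?case
    proof
      fix x assume "x \<in> ((+) K ^^ Suc n) K"
      then obtain k y where "k \<in> K" "y \<in> ((+) K ^^ n) K" "x = k + y"
        by (auto elim: set_plus_elim)
      with Suc.IH obtain m k' where m: "m \<in> P n" "k' \<in> K" "x = k + (\<sigma> m + k')"
        by (auto elim!: set_plus_elim)
      have "k + k' \<in> F + K"
        using assms(2) \<open>k \<in> K\<close> m(2) by blast
      then obtain a k'' where a: "a \<in> F" "k'' \<in> K" "k + k' = a + k''"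
        by (auto elim: set_plus_elim)
      define m' where "m' = m(a := Suc (m a))"
      have m': "m' \<in> P (Suc n)"
        using m(1) a(1) unfolding P_def m'_def
        by (auto simp: PiE_iff extensional_def le_SucI)
      have "(\<Sum>b\<in>F - {a}. \<Sum>i<m' b. b) = (\<Sum>b\<in>F - {a}. \<Sum>i<m b. b)"
        by (rule sum.cong) (auto simp: m'_def)
      then have "\<sigma> m' = a + \<sigma> m"
        using a(1) assms(1) unfolding \<sigma>_def by (simp add: sum.remove[of F a] m'_def algebra_simps)
      then have "x = \<sigma> m' + k''"
        using a(3) m(3) by (metis add.assoc add.commute)
      then show "x \<in> \<sigma> ` P (Suc n) + K"
        using m' a(2) by blast
    qed
  qed
  moreover have "finite (P n)"
    unfolding P_def using assms(1) by (intro finite_PiE) auto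
  moreover have "card (P n) = (n + 1) ^ card F"
    unfolding P_def using assms(1) by (simp add: card_PiE)
  ultimately show ?thesis
    using card_image_le[of "P n" \<sigma>] by (intro that[of "\<sigma> ` P n"]) auto
qed

text \<open>Otherwise \<open>a n\<close> would grow at least like \<open>2 ^ n * a 0\<close>, which
  outruns any polynomial.\<close>

lemma exists_not_doubling:
  fixes a :: "nat \<Rightarrow> real"
  assumes "0 < a 0" and "\<And>n. a n \<le> c * real (n + 1) ^ d"
  shows "\<exists>n. a (Suc n) \<le> 2 * a n"
proof (rule ccontr)
  assume "\<nexists>n. a (Suc n) \<le> 2 * a n"
  then have step: "2 * a n \<le> a (Suc n)" for n
    by (meson linear)
  have lower: "2 ^ n * a 0 \<le> a n" for n
  proof (induction n)
    case (Suc n)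
    then show ?case using step[of n] by simp
  qed simp
  have "(\<lambda>n. (real n + 1) ^ d / 2 ^ n * c) \<longlonglongrightarrow> 0"
    by real_asymp
  then have "\<forall>\<^sub>F n in sequentially. (real n + 1) ^ d / 2 ^ n * c < a 0"
    using assms(1) by (rule order_tendstoD)
  then obtain n where "(real n + 1) ^ d / 2 ^ n * c < a 0"
    by (auto simp: eventually_sequentially)
  then have "c * real (n + 1) ^ d < 2 ^ n * a 0"
    by (simp add: field_simps)
  with lower[of n] assms(2)[of n] show False by linarith
qed

section \<open>Haar measure\<close>

lemma left_haar_sets: "left_haar_measure \<mu> \<Longrightarrow> sets \<mu> = sets borel"
  by (simp add: left_haar_measure_def radon_measure_def)

lemma left_haar_compact:
  assumes "left_haar_measure \<mu>" "compact K"
  shows "K \<in> sets \<mu>" and "emeasure \<mu> K < top" and "emeasure \<mu> K \<noteq> top"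
  using assms by (auto simp: left_haar_measure_def radon_measure_def
      intro: borel_closed compact_imp_closed)

lemma left_haar_translate:
  assumes "left_haar_measure \<mu>" "compact K"
  shows "measure \<mu> ((+) x ` K) = measure \<mu> K"
proof -
  have "K \<in> sets borel"
    using left_haar_compact[OF assms] left_haar_sets[OF assms(1)] by simp
  then show ?thesis
    using assms(1) by (simp add: left_haar_measure_def measure_def)
qed

lemma compact_translate:
  fixes K :: "'a::topological_group_add set"
  assumes "compact K"
  shows "compact ((+) x ` K)"
  by (intro compact_continuous_image assms continuous_intros)

lemma set_plus_eq_UN: "T + K = (\<Union>t\<in>T. (+) t ` K)"
  by (auto simp: set_plus_def)

lemma compact_finite_plus:
  fixes K :: "'a::topological_group_add set"
  assumes "finite T" "compact K"
  shows "compact (T + K)"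
  using compact_set_plus[OF finite_imp_compact] assms .

text \<open>Since \<open>measure\<close> is 0 on sets of infinite measure, monotonicity requires
  finiteness, which compactness supplies.\<close>

lemma left_haar_mono:
  assumes "left_haar_measure \<mu>" "compact K" "compact L" "K \<subseteq> L"
  shows "measure \<mu> K \<le> measure \<mu> L"
  using assms by (intro measure_mono_fmeasurable) (auto simp: left_haar_compact fmeasurable_def)

lemma left_haar_finite_plus_le:
  assumes "left_haar_measure \<mu>" "finite T" "compact K"
  shows "measure \<mu> (T + K) \<le> real (card T) * measure \<mu> K"
proof -
  have "measure \<mu> (T + K) \<le> (\<Sum>t\<in>T. measure \<mu> ((+) t ` K))"
    unfolding set_plus_eq_UN using assms
    by (intro measure_subadditive_finite) (auto simp: left_haar_compact compact_translate)
  then show ?thesis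
    by (simp add: left_haar_translate[OF assms(1,3)])
qed

text \<open>If \<open>V\<close> were null, so would be every compact set, being covered by finitely
  many translates of \<open>V\<close>. Inner regularity on the open set \<open>UNIV\<close> would
  then make the whole measure vanish.\<close>

lemma left_haar_nhd_pos:
  fixes V :: "'a::{topological_group_add, t2_space} set"
  assumes haar: "left_haar_measure \<mu>" and "compact V" and "0 \<in> interior V"
  shows "0 < measure \<mu> V"
proof (rule ccontr)
  assume "\<not> 0 < measure \<mu> V"
  then have V0: "measure \<mu> V = 0"
    by (simp add: zero_less_measure_iff)
  have "emeasure \<mu> C = 0" if "compact C" for C
  proof -
    obtain F where F: "finite F" "C \<subseteq> F + V"
      using compact_covered_by_translates[OF \<open>compact C\<close> assms(3)] .
    have "measure \<mu> C \<le> measure \<mu> (F + V)"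
      using F assms that by (intro left_haar_mono compact_finite_plus)
    also have "\<dots> \<le> 0"
      using left_haar_finite_plus_le[OF haar F(1) assms(2)] V0 by simp
    finally have "measure \<mu> C = 0"
      by (simp add: measure_le_0_iff)
    then show ?thesis
      using left_haar_compact[OF haar that] by (simp add: emeasure_eq_ennreal_measure)
  qed
  then have "(SUP K\<in>{K. compact K \<and> K \<subseteq> UNIV}. emeasure \<mu> K) \<le> 0"
    by (intro SUP_least) auto
  moreover have "emeasure \<mu> UNIV = (SUP K\<in>{K. compact K \<and> K \<subseteq> UNIV}. emeasure \<mu> K)"
    using haar open_UNIV unfolding left_haar_measure_def radon_measure_def by blast
  ultimately have "emeasure \<mu> UNIV = 0" by simp
  then show False
    using haar by (simp add: left_haar_measure_def)
qed

text \<open>Greedy choice: a new translate of \<open>V\<close> misses the old ones as soon as its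
  base point lies outside \<open>T + V - V\<close>, which is compact and hence not the whole
  group.\<close>

lemma disjoint_translates:
  fixes V :: "'a::topological_group_add set"
  assumes "\<not> compact (UNIV :: 'a set)" and "compact V"
  shows "\<exists>T. finite T \<and> card T = n \<and> disjoint_family_on (\<lambda>t. (+) t ` V) T"
proof (induction n)
  case 0
  show ?case by (intro exI[of _ "{}"]) (auto simp: disjoint_family_on_def)
next
  case (Suc n)
  then obtain T where T: "finite T" "card T = n" "disjoint_family_on (\<lambda>t. (+) t ` V) T"
    by blast
  have "compact (T + V + uminus ` V)"
    using T(1) assms(2)
    by (intro compact_set_plus compact_finite_plus compact_continuous_image continuous_intros)
  then obtain x where x: "x \<notin> T + V + uminus ` V"
    using assms(1) by (metis UNIV_eq_I)
  have disj: "(+) x ` V \<inter> (+) t ` V = {}" if "t \<in> T" for t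
  proof (rule ccontr)
    assume "(+) x ` V \<inter> (+) t ` V \<noteq> {}"
    then obtain v w where vw: "v \<in> V" "w \<in> V" "x + v = t + w" by auto
    then have "x = t + w + - v"
      by (metis add_diff_cancel add_uminus_conv_diff)
    then show False
      using x vw that by blast
  qed
  show ?case
  \<comment> \<open>For empty \<open>V\<close> disjointness does not separate the base points, so
    any \<open>Suc n\<close> elements of the infinite group are taken. Otherwise
    \<open>x \<in> T\<close> would make a nonempty translate disjoint from itself.\<close>
  proof (cases "V = {}")
    case True
    obtain T' :: "'a set" where "finite T'" "card T' = Suc n"
      using infinite_arbitrarily_large[of "UNIV :: 'a set" "Suc n"] assms(1) finite_imp_compact
      by auto
    then show ?thesis
      using True by (intro exI[of _ T']) (auto simp: disjoint_family_on_def)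
  next
    case False
    then have "x \<notin> T"
      using disj[of x] by blast
    moreover from this have "disjoint_family_on (\<lambda>t. (+) t ` V) (insert x T)"
      using T(3) disj by (subst disjoint_family_on_insert) (simp_all, blast)
    ultimately show ?thesis
      using T by (intro exI[of _ "insert x T"]) auto
  qed
qed

text \<open>Enough disjoint translates of one compact neighbourhood provide the measure; adjoining
  \<open>V\<close> itself keeps 0 in the interior, and adjoining the negatives gives
  symmetry.\<close>

lemma large_symmetric_compact_nhd:
  fixes \<mu> :: "'a::{topological_group_add, t2_space} measure"
  assumes lc: "locally_compact_space (euclidean :: 'a topology)"
    and haar: "left_haar_measure \<mu>" and nc: "\<not> compact (UNIV :: 'a set)"
  obtains K where "compact K" and "0 \<in> interior K" and "uminus ` K = K" and "r \<le> measure \<mu> K"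
proof -
  obtain U V :: "'a set" where "open U" and V: "compact V" "0 \<in> U" "U \<subseteq> V"
    using lc unfolding locally_compact_space_def
    by (metis UNIV_I topspace_euclidean open_openin compactin_euclidean_iff)
  then have int: "0 \<in> interior V"
    by (meson interiorI)
  obtain n :: nat where n: "r \<le> real n * measure \<mu> V"
    using left_haar_nhd_pos[OF haar V(1) int] using ex_less_of_nat_mult less_imp_le by blast
  obtain T where T: "finite T" "card T = n" "disjoint_family_on (\<lambda>t. (+) t ` V) T"
    using disjoint_translates[OF nc V(1)] by blast
  have "measure \<mu> (T + V) = (\<Sum>t\<in>T. measure \<mu> ((+) t ` V))"
    unfolding set_plus_eq_UN using T haar V(1)
    by (intro measure_finite_Union) (auto simp: left_haar_compact compact_translate)
  then have r: "r \<le> measure \<mu> (T + V)"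
    using n T(2) by (simp add: left_haar_translate[OF haar V(1)])
  define L where "L = V \<union> (T + V)"
  define K where "K = L \<union> uminus ` L"
  have "compact L"
    unfolding L_def using V T by (intro compact_Un compact_finite_plus)
  then have K: "compact K"
    unfolding K_def by (intro compact_Un compact_continuous_image continuous_intros)
  show ?thesis
  proof (rule that[OF K])
    have "V \<subseteq> K" by (auto simp: K_def L_def)
    then show "0 \<in> interior K"
      using int interior_mono by blast
    show "uminus ` K = K"
      unfolding K_def by (auto simp: image_Un image_image)
    have "measure \<mu> (T + V) \<le> measure \<mu> K"
      using haar K V(1) T(1)
      by (intro left_haar_mono compact_finite_plus) (auto simp: K_def L_def)
    with r show "r \<le> measure \<mu> K" by simp
  qed
qed

text \<open>The measures of the iterated sums of \<open>K\<close> are polynomially bounded, so they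
  cannot more than double at every step; \<open>A\<close> is the sum at a step where they do
  not.\<close>

lemma Folner_set:
  fixes K :: "'a::{topological_ab_group_add, t2_space} set"
  assumes haar: "left_haar_measure \<mu>" and K: "compact K" "0 \<in> interior K"
  obtains A where "compact A" and "0 < measure \<mu> A" and "measure \<mu> (K + A) \<le> 2 * measure \<mu> A"
proof -
  define S where "S n = ((+) K ^^ n) K" for n
  have S_Suc: "S (Suc n) = K + S n" for n
    by (simp add: S_def)
  have S: "compact (S n)" for n
  proof (induction n)
    case 0
    show ?case using K(1) by (simp add: S_def)
  next
    case (Suc n)
    then show ?case unfolding S_Suc by (intro compact_set_plus K(1))
  qed
  have "0 \<in> K"
    using K(2) interior_subset by blast
  \<comment> \<open>As \<open>0 \<in> K\<close>, every iterated sum contains \<open>K\<close> and so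
    has positive measure.\<close>
  have K_sub: "K \<subseteq> S n" for n
  proof (induction n)
    case (Suc n)
    then show ?case using set_zero_plus2[OF \<open>0 \<in> K\<close>, of "S n"] unfolding S_Suc by blast
  qed (simp add: S_def)
  have pos: "0 < measure \<mu> K"
    using left_haar_nhd_pos[OF haar K] .
  obtain F where F: "finite F" "K + K \<subseteq> F + K"
    using compact_covered_by_translates[OF compact_set_plus[OF K(1) K(1)] K(2)] .
  have growth: "measure \<mu> (S n) \<le> measure \<mu> K * real (n + 1) ^ card F" for n
  proof -
    obtain T where T: "finite T" "card T \<le> (n + 1) ^ card F" "S n \<subseteq> T + K"
      using iterated_sumset_covered[OF F] unfolding S_def by metis
    have "measure \<mu> (S n) \<le> measure \<mu> (T + K)"
      using haar S T K(1) by (intro left_haar_mono compact_finite_plus)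
    also have "\<dots> \<le> real (card T) * measure \<mu> K"
      by (rule left_haar_finite_plus_le[OF haar T(1) K(1)])
    also have "\<dots> \<le> real (n + 1) ^ card F * measure \<mu> K"
    proof (rule mult_right_mono)
      show "real (card T) \<le> real (n + 1) ^ card F"
        using T(2) by (metis of_nat_mono of_nat_power)
    qed simp
    finally show ?thesis by (simp add: mult.commute)
  qed
  have S_pos: "0 < measure \<mu> (S n)" for n
    using pos left_haar_mono[OF haar K(1) S K_sub] by (rule less_le_trans)
  obtain n where "measure \<mu> (S (Suc n)) \<le> 2 * measure \<mu> (S n)"
    using exists_not_doubling[of "\<lambda>n. measure \<mu> (S n)", OF S_pos growth] by blast
  then show ?thesis
    using that[OF S S_pos] unfolding S_Suc by blast
qed

section \<open>Gliding hump\<close>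

text \<open>Summing the \<open>p\<close>-th powers instead of the functions avoids Minkowski's
  inequality: the normalised indicators weighted by \<open>2 ^ -n\<close> have integrals adding up
  to 2, and \<open>f\<close> is the \<open>p\<close>-th root of their sum. Overlaps of the
  \<open>C n\<close> only enlarge \<open>f\<close>.\<close>

lemma Lp_majorant:
  fixes C :: "nat \<Rightarrow> 'a set"
  assumes C: "\<And>n. C n \<in> sets M" "\<And>n. 1 \<le> measure M (C n)" and "0 < p"
  obtains f :: "'a \<Rightarrow> real" where "f \<in> borel_measurable M" and "\<And>x. 0 \<le> f x"
    and "(\<integral>\<^sup>+ x. ennreal (f x powr p) \<partial>M) < \<infinity>"
    and "\<And>n x. x \<in> C n \<Longrightarrow> (1 / (2 ^ n * measure M (C n))) powr (1 / p) \<le> f x"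
proof -
  define t where "t n x = (1 / (2 ^ n * measure M (C n))) * indicator (C n) x" for n x
  define s where "s x = (\<Sum>n. t n x)" for x
  have pos: "0 < measure M (C n)" for n
    using C(2)[of n] by linarith
  have t0: "0 \<le> t n x" for n x
    by (simp add: t_def)
  \<comment> \<open>The bound \<open>1 \<le> measure M (C n)\<close> makes the series converge at
    every point, so that \<open>s\<close> is a genuine real sum.\<close>
  have t_le: "t n x \<le> (1/2) ^ n" for n x
  proof -
    have "2 ^ n * 1 \<le> 2 ^ n * measure M (C n)"
      using C(2) by (intro mult_left_mono) auto
    then have "1 / (2 ^ n * measure M (C n)) \<le> 1 / 2 ^ n"
      by (intro divide_left_mono) (auto simp: pos)
    then show ?thesis
      by (auto simp: t_def power_one_over indicator_def)
  qed
  have summ: "summable (\<lambda>n. t n x)" for x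
  proof (rule summable_comparison_test')
    show "summable (\<lambda>n. (1/2 :: real) ^ n)"
      by (rule summable_geometric) simp
    show "norm (t n x) \<le> (1/2) ^ n" if "0 \<le> n" for n
      using t0[of n x] t_le[of n x] by simp
  qed
  have s0: "0 \<le> s x" for x
    unfolding s_def using t0 summ by (intro suminf_nonneg)
  have meas_t: "t n \<in> borel_measurable M" for n
    unfolding t_def using C(1) by measurable
  have meas_s: "s \<in> borel_measurable M"
    unfolding s_def using meas_t by (intro borel_measurable_suminf)
  \<comment> \<open>An infinite \<open>emeasure\<close> would give \<open>measure\<close> the value
    0.\<close>
  have emeas: "emeasure M (C n) = ennreal (measure M (C n))" for n
    using pos[of n] by (intro emeasure_eq_ennreal_measure) (auto simp: measure_def)
  have int_t: "(\<integral>\<^sup>+ x. ennreal (t n x) \<partial>M) = ennreal ((1/2) ^ n)" for n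
  proof -
    have "(\<integral>\<^sup>+ x. ennreal (t n x) \<partial>M)
        = (\<integral>\<^sup>+ x. ennreal (1 / (2 ^ n * measure M (C n))) * indicator (C n) x \<partial>M)"
      by (intro nn_integral_cong) (auto simp: t_def indicator_def)
    also have "\<dots> = ennreal (1 / (2 ^ n * measure M (C n))) * ennreal (measure M (C n))"
      using C(1) by (simp add: nn_integral_cmult_indicator emeas)
    also have "\<dots> = ennreal ((1/2) ^ n)"
      using pos[of n] by (simp add: ennreal_mult[symmetric] power_one_over)
    finally show ?thesis .
  qed
  have "(\<integral>\<^sup>+ x. ennreal (s x) \<partial>M) = (\<integral>\<^sup>+ x. (\<Sum>n. ennreal (t n x)) \<partial>M)"
    unfolding s_def using t0 summ by (simp add: suminf_ennreal2)
  also have "\<dots> = (\<Sum>n. \<integral>\<^sup>+ x. ennreal (t n x) \<partial>M)"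
    using meas_t by (intro nn_integral_suminf) auto
  also have "\<dots> = ennreal (\<Sum>n. (1/2) ^ n)"
    unfolding int_t by (intro suminf_ennreal2 summable_geometric) simp_all
  finally have int_s: "(\<integral>\<^sup>+ x. ennreal (s x) \<partial>M) < \<infinity>"
    by simp
  show ?thesis
  proof (rule that[of "\<lambda>x. s x powr (1 / p)"])
    show "(\<lambda>x. s x powr (1 / p)) \<in> borel_measurable M"
      using meas_s by measurable
    have "(s x powr (1 / p)) powr p = s x" for x
      using \<open>0 < p\<close> s0 by (simp add: powr_powr)
    then show "(\<integral>\<^sup>+ x. ennreal ((s x powr (1 / p)) powr p) \<partial>M) < \<infinity>"
      using int_s by simp
    show "(1 / (2 ^ n * measure M (C n))) powr (1 / p) \<le> s x powr (1 / p)" if "x \<in> C n" for n x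
    proof (rule powr_mono2)
      have "t n x \<le> s x"
        unfolding s_def using sum_le_suminf[OF summ, of "{n}"] t0 by simp
      then show "1 / (2 ^ n * measure M (C n)) \<le> s x"
        using that by (simp add: t_def)
    qed (use \<open>0 < p\<close> in auto)
  qed simp
qed

section \<open>Lower bounds for weighted convolution\<close>

lemma weight_diagonal_le:
  fixes \<omega> :: "'a::topological_group_add \<Rightarrow> real"
  assumes "weight \<omega>" and "\<And>x. \<omega> x * \<omega> (- x) < M"
  shows "\<omega> x * \<omega> y \<le> M * \<omega> (x + y)"
proof -
  have pos: "0 < \<omega> z" for z
    using assms(1) by (simp add: weight_def)
  have "\<omega> ((x + y) + - y) \<le> \<omega> (x + y) * \<omega> (- y)"
    using assms(1) unfolding weight_def by blast
  then have "\<omega> x \<le> \<omega> (x + y) * \<omega> (- y)"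
    by (simp add: add.assoc)
  then have "\<omega> x * \<omega> y \<le> \<omega> (x + y) * \<omega> (- y) * \<omega> y"
    using pos[of y] by (intro mult_right_mono) auto
  also have "\<dots> = \<omega> (x + y) * (\<omega> y * \<omega> (- y))"
    by simp
  also have "\<dots> \<le> \<omega> (x + y) * M"
    using pos[of "x + y"] assms(2)[of y] by (intro mult_left_mono) auto
  finally show ?thesis by (simp add: mult.commute)
qed

text \<open>For \<open>y\<close> in \<open>x + K\<close> the point \<open>y\<close> lies in
  \<open>K + A\<close> and, by symmetry of \<open>K\<close>, \<open>- y + x\<close> lies in
  \<open>K\<close>. So both lower bounds apply on a set of measure \<open>|K|\<close>, while the
  integrand is nonnegative elsewhere.\<close>

lemma weighted_convolution_lower_bound:
  fixes \<omega> f g :: "'a::{topological_ab_group_add, t2_space} \<Rightarrow> real"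
  assumes haar: "left_haar_measure \<mu>" and \<omega>: "weight \<omega>" and M: "\<And>x. \<omega> x * \<omega> (- x) < M"
    and K: "compact K" "uminus ` K = K" and "x \<in> A"
    and f: "\<And>y. 0 \<le> f y" "\<And>y. y \<in> K + A \<Longrightarrow> \<alpha> \<le> f y" "0 \<le> \<alpha>"
    and g: "\<And>y. 0 \<le> g y" "\<And>y. y \<in> K \<Longrightarrow> \<beta> \<le> g y" "0 \<le> \<beta>"
    and int: "integrable \<mu> (\<lambda>y. (f y / \<omega> y) * (g (- y + x) / \<omega> (- y + x)))"
  shows "\<alpha> * \<beta> * measure \<mu> K \<le> M * \<omega> x * (\<integral>y. (f y / \<omega> y) * (g (- y + x) / \<omega> (- y + x)) \<partial>\<mu>)"
proof -
  have pos: "0 < \<omega> z" for z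
    using \<omega> by (simp add: weight_def)
  have "0 < M"
    using M[of 0] pos[of 0] by (smt (verit) mult_pos_pos minus_zero)
  define L where "L = (+) x ` K"
  have L: "compact L"
    unfolding L_def using K(1) by (rule compact_translate)
  have "measure \<mu> K = measure \<mu> L"
    unfolding L_def using left_haar_translate[OF haar K(1)] by simp
  define c where "c = \<alpha> * \<beta> / (M * \<omega> x)"
  have "(\<integral>y. c * indicator L y \<partial>\<mu>) \<le> (\<integral>y. (f y / \<omega> y) * (g (- y + x) / \<omega> (- y + x)) \<partial>\<mu>)"
  proof (rule integral_mono[OF _ int])
    show "integrable \<mu> (\<lambda>y. c * indicator L y)"
      using left_haar_compact[OF haar L] by (intro integrable_mult_right integrable_real_indicator) auto
    fix y
    show "c * indicator L y \<le> (f y / \<omega> y) * (g (- y + x) / \<omega> (- y + x))"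
    proof (cases "y \<in> L")
      case True
      then obtain k where k: "k \<in> K" "y = x + k" by (auto simp: L_def)
      have "k + x \<in> K + A"
        using k \<open>x \<in> A\<close> by blast
      then have "\<alpha> \<le> f y"
        using f(2) k(2) by (simp add: add.commute)
      have "- k \<in> K" using K(2) k(1) by blast
      moreover have "- y + x = - k" using k by simp
      ultimately have "\<beta> \<le> g (- y + x)"
        using g(2) by simp
      have "c \<le> (f y * g (- y + x)) / (M * \<omega> x)"
        unfolding c_def using \<open>\<alpha> \<le> f y\<close> \<open>\<beta> \<le> g (- y + x)\<close> f(1,3) g(1,3) \<open>0 < M\<close> pos[of x]
        by (intro divide_right_mono mult_mono) auto
      \<comment> \<open>\<open>weight_diagonal_le\<close> is applied to \<open>y\<close> and
        \<open>- y + x\<close>, whose sum is \<open>x\<close>; the resulting bound does not depend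
        on \<open>y\<close>.\<close>
      also have "\<dots> \<le> (f y * g (- y + x)) / (\<omega> y * \<omega> (- y + x))"
        using weight_diagonal_le[OF \<omega> M, of y "- y + x"] f(1) g(1) \<open>0 < M\<close> pos
        by (intro divide_left_mono) (auto intro!: mult_pos_pos)
      finally show ?thesis using True by simp
    next
      case False
      then show ?thesis
        using f(1) g(1) pos by (auto intro!: mult_nonneg_nonneg divide_nonneg_pos)
    qed
  qed
  then have "c * measure \<mu> K \<le> (\<integral>y. (f y / \<omega> y) * (g (- y + x) / \<omega> (- y + x)) \<partial>\<mu>)"
    using left_haar_compact[OF haar L] \<open>measure \<mu> K = measure \<mu> L\<close> by simp
  then show ?thesis
    using \<open>0 < M\<close> pos[of x] by (simp add: c_def field_simps)
qed

text \<open>Here \<open>k\<close>, \<open>a\<close>, \<open>b\<close> stand for the measures of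
  \<open>K\<close>, \<open>A\<close>, \<open>K + A\<close>. The two normalisations cost
  \<open>4 ^ n\<close>, the ratio \<open>a / b\<close> costs a factor 2, and
  \<open>8 ^ n \<le> k powr (p - 1)\<close> leaves \<open>2 ^ n\<close>.\<close>

lemma powr_hump_bound:
  fixes k a b M p :: real
  assumes "1 < p" "0 < k" "0 < b" "b \<le> 2 * a" "0 < M" "8 ^ n \<le> k powr (p - 1)"
  shows "2 ^ n \<le> 2 * M powr p
    * (((1 / (2 ^ n * b)) powr (1 / p) * (1 / (2 ^ n * k)) powr (1 / p) * k / M) powr p * a)"
proof -
  define X where "X = (1 / (2 ^ n * b)) powr (1 / p) * (1 / (2 ^ n * k)) powr (1 / p) * k / M"
  have "X powr p = (1 / (2 ^ n * b)) * (1 / (2 ^ n * k)) * k powr p / M powr p"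
    unfolding X_def using assms by (simp add: powr_mult powr_divide powr_powr)
  also have "\<dots> = k powr (p - 1) / (4 ^ n * b * M powr p)"
    using assms by (simp add: powr_diff field_simps power_mult_distrib[symmetric])
  finally have X: "X powr p = k powr (p - 1) / (4 ^ n * b * M powr p)" .
  have "2 ^ n * 4 ^ n = (8::real) ^ n"
    by (simp add: power_mult_distrib[symmetric])
  then have "2 ^ n * 4 ^ n * b \<le> k powr (p - 1) * (2 * a)"
    using assms by (intro mult_mono) auto
  then have "2 ^ n \<le> 2 * (k powr (p - 1) / (4 ^ n * b)) * a"
    using assms by (simp add: field_simps)
  also have "\<dots> = 2 * M powr p * (X powr p * a)"
    unfolding X using assms by simp
  finally show ?thesis
    unfolding X_def .
qed

section \<open>The contradiction in a noncompact group\<close>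

theorem theorem4:
  fixes \<mu> :: "'a::{topological_ab_group_add, t2_space} measure"
    and \<omega> :: "'a \<Rightarrow> real"
    and p :: real
  assumes "locally_compact_space (euclidean :: 'a topology)"
    and "left_haar_measure \<mu>"
    and "1 < p"
    and "weight \<omega>"
    and "diagonally_bounded \<omega>"
    and "closed_under_convolution \<mu> p \<omega>"
  shows "compact (UNIV :: 'a set)"
proof (rule ccontr)
  assume nc: "\<not> compact (UNIV :: 'a set)"
  note haar = assms(2)
  have pos: "0 < \<omega> x" for x
    using assms(4) by (simp add: weight_def)
  have meas_\<omega>[measurable]: "\<omega> \<in> borel_measurable \<mu>"
    using assms(4) left_haar_sets[OF haar] by (simp add: weight_def cong: measurable_cong_sets)
  obtain M where "0 < M" and M: "\<And>x. \<omega> x * \<omega> (- x) < M"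
    using assms(5) by (auto simp: diagonally_bounded_def)

  \<comment> \<open>The size is chosen so that \<open>measure \<mu> (K n) powr (p - 1)\<close> is at
    least \<open>8 ^ n\<close>, as \<open>powr_hump_bound\<close> requires.\<close>
  have "\<forall>n. \<exists>K. compact K \<and> 0 \<in> interior K \<and> uminus ` K = K
      \<and> (8 ^ n) powr (1 / (p - 1)) \<le> measure \<mu> K"
    using large_symmetric_compact_nhd[OF assms(1) haar nc] by metis
  then obtain K where K: "\<And>n. compact (K n)" "\<And>n. 0 \<in> interior (K n)" "\<And>n. uminus ` K n = K n"
      and K_large: "\<And>n. (8 ^ n) powr (1 / (p - 1)) \<le> measure \<mu> (K n)"
    by metis
  have "\<forall>n. \<exists>A. compact A \<and> 0 < measure \<mu> A \<and> measure \<mu> (K n + A) \<le> 2 * measure \<mu> A"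
    using Folner_set[OF haar K(1,2)] by metis
  then obtain A where A: "\<And>n. compact (A n)" "\<And>n. 0 < measure \<mu> (A n)"
      "\<And>n. measure \<mu> (K n + A n) \<le> 2 * measure \<mu> (A n)"
    by metis
  define B where "B n = K n + A n" for n
  have B: "compact (B n)" for n
    unfolding B_def by (intro compact_set_plus K A)
  have K1: "1 \<le> measure \<mu> (K n)" for n
    using K_large[of n] ge_one_powr_ge_zero[of "8 ^ n" "1 / (p - 1)"] assms(3) by auto
  have K8: "8 ^ n \<le> measure \<mu> (K n) powr (p - 1)" for n
    using powr_mono2[OF _ _ K_large[of n], of "p - 1"] assms(3) by (simp add: powr_powr)
  \<comment> \<open>\<open>B n\<close> contains a translate of \<open>K n\<close>, so it is large
    enough for \<open>Lp_majorant\<close>.\<close>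
  have B1: "1 \<le> measure \<mu> (B n)" for n
  proof -
    obtain a where "a \<in> A n"
      using A(2)[of n] by fastforce
    then have "(+) a ` K n \<subseteq> B n"
      unfolding B_def by (auto simp: add.commute[of a])
    then show ?thesis
      using left_haar_mono[OF haar compact_translate[OF K(1)] B] left_haar_translate[OF haar K(1)] K1[of n]
      by fastforce
  qed

  define \<alpha> where "\<alpha> n = (1 / (2 ^ n * measure \<mu> (B n))) powr (1 / p)" for n :: nat
  define \<beta> where "\<beta> n = (1 / (2 ^ n * measure \<mu> (K n))) powr (1 / p)" for n :: nat
  obtain f where f[measurable]: "f \<in> borel_measurable \<mu>" and f0: "\<And>x. 0 \<le> f x"
      and f_int: "(\<integral>\<^sup>+ x. ennreal (f x powr p) \<partial>\<mu>) < \<infinity>"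
      and f_ge: "\<And>n x. x \<in> B n \<Longrightarrow> \<alpha> n \<le> f x"
    using Lp_majorant[of B \<mu> p] left_haar_compact[OF haar B] B1 assms(3) unfolding \<alpha>_def by auto
  obtain g where g[measurable]: "g \<in> borel_measurable \<mu>" and g0: "\<And>x. 0 \<le> g x"
      and g_int: "(\<integral>\<^sup>+ x. ennreal (g x powr p) \<partial>\<mu>) < \<infinity>"
      and g_ge: "\<And>n x. x \<in> K n \<Longrightarrow> \<beta> n \<le> g x"
    using Lp_majorant[of K \<mu> p] left_haar_compact[OF haar K(1)] K1 assms(3) unfolding \<beta>_def by auto
  \<comment> \<open>Dividing by \<open>\<omega>\<close> cancels the weight in the norm, so
    unweighted functions can be used in the weighted space.\<close>
  have in_Lp: "(\<lambda>x. complex_of_real (u x / \<omega> x)) \<in> weighted_Lp \<mu> p \<omega>"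
    if [measurable]: "u \<in> borel_measurable \<mu>" and "\<And>x. 0 \<le> u x"
      and "(\<integral>\<^sup>+ x. ennreal (u x powr p) \<partial>\<mu>) < \<infinity>" for u
  proof -
    have "cmod (complex_of_real (u x / \<omega> x) * complex_of_real (\<omega> x)) = u x" for x
      using pos[of x] that(2)[of x] by (simp add: norm_divide)
    moreover have "(\<lambda>x. complex_of_real (u x / \<omega> x)) \<in> borel_measurable \<mu>"
      by measurable
    ultimately show ?thesis
      using that(3) by (simp add: weighted_Lp_def)
  qed
  \<comment> \<open>The factors are real, so integrability and the value of the complex convolution
    reduce to those of a real integrand.\<close>
  define I where "I x y = (f y / \<omega> y) * (g (- y + x) / \<omega> (- y + x))" for x y
  obtain h where h: "h \<in> weighted_Lp \<mu> p \<omega>"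
      and ae: "AE x in \<mu>. integrable \<mu> (I x)" "AE x in \<mu>. complex_of_real (\<integral>y. I x y \<partial>\<mu>) = h x"
  proof -
    define F G where "F = (\<lambda>x. complex_of_real (f x / \<omega> x))"
      and "G = (\<lambda>x. complex_of_real (g x / \<omega> x))"
    have FG: "F y * G (- y + x) = complex_of_real (I x y)" for x y
      by (simp add: F_def G_def I_def)
    have "F \<in> weighted_Lp \<mu> p \<omega>" "G \<in> weighted_Lp \<mu> p \<omega>"
      unfolding F_def G_def by (rule in_Lp[OF f f0 f_int], rule in_Lp[OF g g0 g_int])
    then have "(AE x in \<mu>. integrable \<mu> (\<lambda>y. F y * G (- y + x)))
        \<and> (\<exists>h\<in>weighted_Lp \<mu> p \<omega>. AE x in \<mu>. convolution \<mu> F G x = h x)"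
      using assms(6) unfolding closed_under_convolution_def by blast
    then show ?thesis
      unfolding convolution_def FG complex_of_real_integrable_eq integral_complex_of_real
      using that by blast
  qed

  \<comment> \<open>\<open>c n\<close> bounds \<open>|h \<omega>|\<close> from below almost
    everywhere on \<open>A n\<close>. The function \<open>h\<close> is fixed before
    \<open>n\<close>, so one finite \<open>J\<close> has to dominate every hump.\<close>
  define c where "c n = \<alpha> n * \<beta> n * measure \<mu> (K n) / M" for n
  define J where "J = (\<integral>\<^sup>+ x. ennreal (cmod (h x * complex_of_real (\<omega> x)) powr p) \<partial>\<mu>)"
  have "J < \<infinity>"
    using h by (simp add: J_def weighted_Lp_def)
  have c0: "0 \<le> c n" for n
    using \<open>0 < M\<close> by (simp add: c_def \<alpha>_def \<beta>_def)
  have lower: "c n powr p * measure \<mu> (A n) \<le> enn2real J" for n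
  proof -
    have "AE x in \<mu>. ennreal (c n powr p) * indicator (A n) x
        \<le> ennreal (cmod (h x * complex_of_real (\<omega> x)) powr p)"
      using ae
    proof eventually_elim
      case (elim x)
      show ?case
      proof (cases "x \<in> A n")
        case True
        have "\<alpha> n * \<beta> n * measure \<mu> (K n) \<le> M * \<omega> x * (\<integral>y. I x y \<partial>\<mu>)"
          unfolding I_def
        proof (rule weighted_convolution_lower_bound[OF haar assms(4) M K(1,3) True f0 _ _ g0 g_ge])
          show "\<alpha> n \<le> f y" if "y \<in> K n + A n" for y
            using f_ge that unfolding B_def .
          show "integrable \<mu> (\<lambda>y. f y / \<omega> y * (g (- y + x) / \<omega> (- y + x)))"
            using elim(1) unfolding I_def .
        qed (simp_all add: \<alpha>_def \<beta>_def)
        then have "c n \<le> \<omega> x * (\<integral>y. I x y \<partial>\<mu>)"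
          using \<open>0 < M\<close> by (simp add: c_def field_simps)
        also have "\<dots> \<le> cmod (complex_of_real (\<omega> x * (\<integral>y. I x y \<partial>\<mu>)))"
          by (simp only: norm_of_real abs_ge_self)
        also have "\<dots> = cmod (h x * complex_of_real (\<omega> x))"
          unfolding elim(2)[symmetric] by (simp add: norm_mult abs_mult)
        finally have "c n \<le> cmod (h x * complex_of_real (\<omega> x))" .
        then have "c n powr p \<le> cmod (h x * complex_of_real (\<omega> x)) powr p"
          using c0 assms(3) by (intro powr_mono2) auto
        then show ?thesis
          using True by (simp add: ennreal_leI)
      qed simp
    qed
    then have "(\<integral>\<^sup>+ x. ennreal (c n powr p) * indicator (A n) x \<partial>\<mu>) \<le> J"
      unfolding J_def by (rule nn_integral_mono_AE)
    then have "ennreal (c n powr p * measure \<mu> (A n)) \<le> J"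
      using left_haar_compact[OF haar A(1)]
      by (simp add: nn_integral_cmult_indicator emeasure_eq_ennreal_measure ennreal_mult)
    \<comment> \<open>Finiteness of \<open>J\<close> matters here, because \<open>enn2real\<close>
      sends infinity to 0.\<close>
    then show ?thesis
      using \<open>J < \<infinity>\<close> enn2real_mono[of "ennreal (c n powr p * measure \<mu> (A n))" J] by simp
  qed
  have "2 ^ n \<le> 2 * M powr p * enn2real J" for n
  proof -
    have "2 ^ n \<le> 2 * M powr p * (c n powr p * measure \<mu> (A n))"
      unfolding c_def \<alpha>_def \<beta>_def
    proof (rule powr_hump_bound)
      show "0 < measure \<mu> (K n)" "0 < measure \<mu> (B n)"
        using K1[of n] B1[of n] by linarith+
      show "measure \<mu> (B n) \<le> 2 * measure \<mu> (A n)"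
        using A(3) by (simp add: B_def)
    qed (use assms(3) \<open>0 < M\<close> K8 in auto)
    also have "\<dots> \<le> 2 * M powr p * enn2real J"
      using lower by (intro mult_left_mono) auto
    finally show ?thesis .
  qed
  moreover obtain n where "2 * M powr p * enn2real J < 2 ^ n"
    using real_arch_pow[of 2] by auto
  ultimately show False
    by (meson not_less)
qed

end
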